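(* Let $f\in F\langle X|\mathbb{Z}\rangle$ be a multilinear polynomial, let $E^{c}=\bigoplus_{r\in\mathbb{Z}}A_r$ be the Grassmann algebra $E$ endowed with a central $\mathbb{Z}$-grading, and let $E_d$ be $E$ endowed with the induced $\mathbb{Z}_2$-grading. Then $f\in T_{\mathbb{Z}}(E^{c})$ if and only if $\pi(f)\in T_2(E_d)$.
   Context: $F$ is a field of characteristic zero; all algebras are associative and unitary over $F$. $E$ is the infinite dimensional Grassmann algebra over $F$: $L$ is the vector space with basis $e_1,e_2,\ldots$, and $E$ has basis $B_E$ consisting of $1$ and all products $e_{i_1}\cdots e_{i_k}$ with $i_1<\cdots<i_k$, $k\ge 1$, with multiplication induced by $e_ie_j=-e_je_i$. For $w=e_{i_1}\cdots e_{i_k}\in B_E$, $\mathrm{supp}(w)=\{e_{i_1},\ldots,e_{i_k}\}$ and the length of $w$ is $k$; two such elements have disjoint supports if the sets are disjoint. A $\mathbb{Z}$-grading $E=\bigoplus_{r\in\mathbb{Z}}A_r$ is homogeneous if each $e_i$ is homogeneous, and of full support if $A_r\neq0$ for all $r\in\mathbb{Z}$. A central $\mathbb{Z}$-grading on $E$ is a homogeneous $\mathbb{Z}$-grading of full support such that, for every $h\in 2\mathbb{Z}$, $A_h$ contains infinitely many elements of $B_E$ of even length with pairwise disjoint supports. The induced $\mathbb{Z}_2$-grading is $E_d=A_{\overline0}\oplus A_{\overline1}$, where $A_{\overline0}=\bigoplus_{r\text{ even}}A_r$, $A_{\overline1}=\bigoplus_{r\text{ odd}}A_r$. For $G=\mathbb{Z}$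 or $\mathbb{Z}_2$, $F\langle X|G\rangle$ is the free unitary associative algebra on the disjoint union of countably infinite sets of variables of degree $g$, $g\in G$, with the natural $G$-grading. $T_{\mathbb{Z}}(A)$ (resp. $T_2(A)$) is the set of graded polynomial identities of a $\mathbb{Z}$-graded (resp. $\mathbb{Z}_2$-graded) algebra $A$, i.e. polynomials vanishing under all substitutions of variables by elements of $A$ of the same degree. The map $\pi\colon F\langle X|\mathbb{Z}\rangle\to F\langle X|\mathbb{Z}_2\rangle$ is the homomorphism of free algebras reducing degrees of variables modulo $2$: it sends each variable of $\mathbb{Z}$-degree $n$ to a variable of $\mathbb{Z}_2$-degree $\overline n$ ($x_i^n\mapsto x_i^{\overline n}$), with the convention that distinct variables of $F\langle X|\mathbb{Z}\rangle$ are sent to distinct variables of $F\langle X|\mathbb{Z}_2\rangle$. *)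

theory Defs
  imports Complex_Main "HOL-Library.Poly_Mapping" "HOL-Library.Z2" "HOL-Library.Countable"
begin

section \<open>Free algebras\<close>

text \<open>Words form a type of their own because multiplication on \<open>\<Rightarrow>\<^sub>0\<close> requires an additive
  monoid of exponents: addition of words is concatenation.\<close>

datatype 'v free_word = Word (letters: "'v list")

instantiation free_word :: (type) monoid_add
begin

definition zero_free_word :: "'a free_word" where "0 = Word []"
definition plus_free_word :: "'a free_word \<Rightarrow> 'a free_word \<Rightarrow> 'a free_word"
  where "u + w = Word (letters u @ letters w)"

instance by standard (auto simp: zero_free_word_def plus_free_word_def)

end

lemma letters_zero [simp]: "letters 0 = []"
  by (simp add: zero_free_word_def)

lemma letters_plus [simp]: "letters (u + w) = letters u @ letters w"
  by (simp add: plus_free_word_def)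

text \<open>\<open>('g, 'a) free_algebra\<close> is \<open>F\<langle>X|G\<rangle>\<close>: the variable \<open>(g, i)\<close> is the \<open>i\<close>-th variable of degree \<open>g\<close>.\<close>

type_synonym ('g, 'a) free_algebra = "('g \<times> nat) free_word \<Rightarrow>\<^sub>0 'a"

definition var :: "'v \<Rightarrow> 'v free_word \<Rightarrow>\<^sub>0 'a::zero_neq_one"
  where "var v = Poly_Mapping.single (Word [v]) 1"

definition free_scale :: "'a::field \<Rightarrow> ('v free_word \<Rightarrow>\<^sub>0 'a) \<Rightarrow> ('v free_word \<Rightarrow>\<^sub>0 'a)"
  where "free_scale c f = Poly_Mapping.map ((*) c) f"

definition multilinear :: "('v free_word \<Rightarrow>\<^sub>0 'a::zero) \<Rightarrow> bool"
  where "multilinear f \<longleftrightarrow>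
    (\<exists>V. finite V \<and> (\<forall>w\<in>Poly_Mapping.keys f. distinct (letters w) \<and> set (letters w) = V))"

lemma sum_singles: "f = (\<Sum>w\<in>Poly_Mapping.keys f. Poly_Mapping.single w (Poly_Mapping.lookup f w))"
proof (rule poly_mapping_eqI)
  fix k
  show "Poly_Mapping.lookup f k = Poly_Mapping.lookup (\<Sum>w\<in>Poly_Mapping.keys f. Poly_Mapping.single w (Poly_Mapping.lookup f w)) k"
    by (auto simp: lookup_sum lookup_single when_def Poly_Mapping.in_keys_iff)
qed


section \<open>Graded algebras and graded identities\<close>

locale unital_algebra = vector_space scale
  for scale :: "'a::field \<Rightarrow> 'b::ring_1 \<Rightarrow> 'b" (infixr \<open>*s\<close> 75) +
  assumes mult_scale_left: "(c *s x) * y = c *s (x * y)"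
    and mult_scale_right: "x * (c *s y) = c *s (x * y)"
begin

definition grading :: "('g::ab_group_add \<Rightarrow> 'b set) \<Rightarrow> bool"
  where "grading A \<longleftrightarrow>
    (\<forall>g. subspace (A g)) \<and>
    (\<forall>x. \<exists>!c. finite {g. c g \<noteq> 0} \<and> (\<forall>g. c g \<in> A g) \<and> x = (\<Sum>g | c g \<noteq> 0. c g)) \<and>
    (\<forall>g h. \<forall>x\<in>A g. \<forall>y\<in>A h. x * y \<in> A (g + h))"

text \<open>The value at \<open>f\<close> of the unital algebra homomorphism that sends each variable \<open>v\<close> to \<open>\<phi> v\<close>.\<close>

definition eval :: "('v \<Rightarrow> 'b) \<Rightarrow> ('v free_word \<Rightarrow>\<^sub>0 'a) \<Rightarrow> 'b"
  where "eval \<phi> f = (\<Sum>w\<in>Poly_Mapping.keys f. Poly_Mapping.lookup f w *s prod_list (map \<phi> (letters w)))"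

definition graded_identities :: "('g \<Rightarrow> 'b set) \<Rightarrow> ('g, 'a) free_algebra set"
  where "graded_identities A = {f. \<forall>\<phi>. (\<forall>g i. \<phi> (g, i) \<in> A g) \<longrightarrow> eval \<phi> f = 0}"

text \<open>The sum of the \<open>A r\<close> over all \<open>r\<close> in a residue class modulo 2; \<open>bit\<close> is the two-element field.\<close>

definition induced_grading :: "(int \<Rightarrow> 'b set) \<Rightarrow> bit \<Rightarrow> 'b set"
  where "induced_grading A d = span (\<Union>r\<in>{r. of_int r = d}. A r)"

lemma eval_superset:
  assumes "finite W" "Poly_Mapping.keys f \<subseteq> W"
  shows "eval \<phi> f = (\<Sum>w\<in>W. Poly_Mapping.lookup f w *s prod_list (map \<phi> (letters w)))"
  unfolding eval_def
  by (rule sum.mono_neutral_left) (use assms in \<open>auto simp: Poly_Mapping.in_keys_iff\<close>)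

lemma eval_add: "eval \<phi> (f + g) = eval \<phi> f + eval \<phi> g"
proof -
  let ?W = "Poly_Mapping.keys f \<union> Poly_Mapping.keys g"
  have "Poly_Mapping.keys (f + g) \<subseteq> ?W"
    by (rule keys_add)
  then show ?thesis
    by (simp add: eval_superset[of ?W] lookup_add scale_left_distrib sum.distrib)
qed

lemma eval_zero [simp]: "eval \<phi> 0 = 0"
  by (simp add: eval_def)

lemma eval_sum: "eval \<phi> (sum f I) = (\<Sum>i\<in>I. eval \<phi> (f i))"
  by (induction I rule: infinite_finite_induct) (auto simp: eval_add)

lemma eval_single: "eval \<phi> (Poly_Mapping.single w c) = c *s prod_list (map \<phi> (letters w))"
  by (simp add: eval_superset[of "{w}"])

lemma eval_var: "eval \<phi> (var v) = \<phi> v"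
  by (simp add: var_def eval_single)

lemma eval_one: "eval \<phi> 1 = 1"
  using eval_single[of \<phi> 0 1] by simp

lemma eval_mult: "eval \<phi> (f * g) = eval \<phi> f * eval \<phi> g"
proof -
  have single: "eval \<phi> (Poly_Mapping.single u c * Poly_Mapping.single w d) =
      eval \<phi> (Poly_Mapping.single u c) * eval \<phi> (Poly_Mapping.single w d)" for u w c d
    by (simp add: mult_single eval_single mult_scale_left mult_scale_right mult.commute)
  define I J where "I = Poly_Mapping.keys f" and "J = Poly_Mapping.keys g"
  define p where "p = (\<lambda>w. Poly_Mapping.single w (Poly_Mapping.lookup f w))"
  define q where "q = (\<lambda>w. Poly_Mapping.single w (Poly_Mapping.lookup g w))"
  have f: "f = sum p I" and g: "g = sum q J"
    unfolding p_def q_def I_def J_def by (rule sum_singles)+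
  show ?thesis
    unfolding f g by (simp only: sum_product eval_sum) (simp only: p_def q_def single)
qed

end

lemma lookup_free_scale [simp]: "Poly_Mapping.lookup (free_scale c f) w = c * Poly_Mapping.lookup f w"
  by (simp add: free_scale_def map.rep_eq when_def)

lemma free_scale_conv_mult: "free_scale c f = Poly_Mapping.single 0 c * f"
  unfolding free_scale_def by (rule mult_map_scale_conv_mult)

lemma single_zero_commute: "f * Poly_Mapping.single 0 c = Poly_Mapping.single 0 c * f"
  for f :: "'v free_word \<Rightarrow>\<^sub>0 'a::field"
proof -
  have "(\<Sum>w\<in>Poly_Mapping.keys f. Poly_Mapping.single w (Poly_Mapping.lookup f w)) * Poly_Mapping.single 0 c =
      Poly_Mapping.single 0 c * (\<Sum>w\<in>Poly_Mapping.keys f. Poly_Mapping.single w (Poly_Mapping.lookup f w))"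
    unfolding sum_distrib_left sum_distrib_right by (simp add: mult_single mult.commute)
  then show ?thesis
    unfolding sum_singles[symmetric] .
qed

interpretation free: unital_algebra "free_scale :: 'a::field \<Rightarrow> ('v free_word \<Rightarrow>\<^sub>0 'a) \<Rightarrow> _"
proof
  fix a b :: 'a and x y :: "'v free_word \<Rightarrow>\<^sub>0 'a"
  show "free_scale a (x + y) = free_scale a x + free_scale a y"
    "free_scale (a + b) x = free_scale a x + free_scale b x"
    "free_scale a (free_scale b x) = free_scale (a * b) x"
    "free_scale 1 x = x"
    by (auto intro!: poly_mapping_eqI simp: lookup_add algebra_simps)
  show "free_scale a x * y = free_scale a (x * y)"
    by (simp add: free_scale_conv_mult mult.assoc)
  show "x * free_scale a y = free_scale a (x * y)"
    unfolding free_scale_conv_mult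
    by (metis mult.assoc single_zero_commute)
qed

text \<open>A degree-preserving choice of the images of the variables, distinct variables having distinct
  images.  The homomorphism \<open>\<pi>\<close> is determined by this choice.\<close>

definition reduces_mod_2 :: "(int \<times> nat \<Rightarrow> bit \<times> nat) \<Rightarrow> bool"
  where "reduces_mod_2 \<sigma> \<longleftrightarrow> inj \<sigma> \<and> (\<forall>n i. fst (\<sigma> (n, i)) = of_int n)"

lemma ex_reduces_mod_2: "\<exists>\<sigma>. reduces_mod_2 \<sigma>"
proof
  show "reduces_mod_2 (\<lambda>(n, i). (of_int n, to_nat (n, i)))"
    by (auto simp: reduces_mod_2_def inj_def)
qed

definition reduction :: "(int \<times> nat \<Rightarrow> bit \<times> nat) \<Rightarrow>
    (int, 'a::field) free_algebra \<Rightarrow> (bit, 'a) free_algebra"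
  where "reduction \<sigma> = free.eval (\<lambda>v. var (\<sigma> v))"


section \<open>The Grassmann algebra\<close>

text \<open>An element is given by its coordinates in the basis: the finite set \<open>{i\<^sub>1 < \<dots> < i\<^sub>k}\<close>
  indexes \<open>e\<^bsub>i\<^sub>1\<^esub> \<cdots> e\<^bsub>i\<^sub>k\<^esub>\<close>, and the empty set indexes \<open>1\<close>.\<close>

typedef (overloaded) 'a grassmann =
  "{x :: nat set \<Rightarrow> 'a::zero. finite {S. x S \<noteq> 0} \<and> (\<forall>S. x S \<noteq> 0 \<longrightarrow> finite S)}"
  morphisms coord Abs_grassmann
  by (rule exI[of _ "\<lambda>_. 0"]) auto

setup_lifting type_definition_grassmann

text \<open>The sign of the permutation that sorts the concatenation of \<open>S\<close> and \<open>T\<close>.\<close>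

definition shuffle_sign :: "nat set \<Rightarrow> nat set \<Rightarrow> 'a::ring_1"
  where "shuffle_sign S T = (- 1) ^ card {(i, j). i \<in> S \<and> j \<in> T \<and> j < i}"

lemma finite_inversions:
  "finite S \<Longrightarrow> finite T \<Longrightarrow> finite {(i, j). i \<in> S \<and> j \<in> T \<and> j < (i::nat)}"
  by (rule finite_subset[of _ "S \<times> T"]) auto

lemma shuffle_sign_Un_left:
  assumes "finite S" "finite T" "finite R" "S \<inter> T = {}"
  shows "shuffle_sign (S \<union> T) R = shuffle_sign S R * (shuffle_sign T R :: 'a::ring_1)"
proof -
  have "{(i, j). i \<in> S \<union> T \<and> j \<in> R \<and> j < i} =
      {(i, j). i \<in> S \<and> j \<in> R \<and> j < i} \<union> {(i, j). i \<in> T \<and> j \<in> R \<and> j < i}"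
    by auto
  moreover have "card \<dots> = card {(i, j). i \<in> S \<and> j \<in> R \<and> j < i} + card {(i, j). i \<in> T \<and> j \<in> R \<and> j < i}"
    by (rule card_Un_disjoint) (use assms in \<open>auto intro: finite_inversions\<close>)
  ultimately show ?thesis
    by (simp add: shuffle_sign_def power_add)
qed

lemma shuffle_sign_Un_right:
  assumes "finite S" "finite T" "finite R" "T \<inter> R = {}"
  shows "shuffle_sign S (T \<union> R) = shuffle_sign S T * (shuffle_sign S R :: 'a::ring_1)"
proof -
  have "{(i, j). i \<in> S \<and> j \<in> T \<union> R \<and> j < i} =
      {(i, j). i \<in> S \<and> j \<in> T \<and> j < i} \<union> {(i, j). i \<in> S \<and> j \<in> R \<and> j < i}"
    by auto
  moreover have "card \<dots> = card {(i, j). i \<in> S \<and> j \<in> T \<and> j < i} + card {(i, j). i \<in> S \<and> j \<in> R \<and> j < i}"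
    by (rule card_Un_disjoint) (use assms in \<open>auto intro: finite_inversions\<close>)
  ultimately show ?thesis
    by (simp add: shuffle_sign_def power_add)
qed

lemma shuffle_sign_empty [simp]: "shuffle_sign {} T = 1" "shuffle_sign S {} = 1"
  by (simp_all add: shuffle_sign_def)

instantiation grassmann :: (comm_ring_1) ring_1
begin

lift_definition zero_grassmann :: "'a grassmann" is "\<lambda>_. 0"
  by simp

lift_definition one_grassmann :: "'a grassmann" is "\<lambda>S. if S = {} then 1 else 0"
  by simp

lift_definition plus_grassmann :: "'a grassmann \<Rightarrow> 'a grassmann \<Rightarrow> 'a grassmann"
  is "\<lambda>x y S. x S + y S"
proof -
  fix x y :: "nat set \<Rightarrow> 'a"
  assume x: "finite {S. x S \<noteq> 0} \<and> (\<forall>S. x S \<noteq> 0 \<longrightarrow> finite S)"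
    and y: "finite {S. y S \<noteq> 0} \<and> (\<forall>S. y S \<noteq> 0 \<longrightarrow> finite S)"
  have "{S. x S + y S \<noteq> 0} \<subseteq> {S. x S \<noteq> 0} \<union> {S. y S \<noteq> 0}"
    by auto
  moreover have "finite S" if "x S + y S \<noteq> 0" for S
    using x y that by (cases "x S = 0") auto
  ultimately show "finite {S. x S + y S \<noteq> 0} \<and> (\<forall>S. x S + y S \<noteq> 0 \<longrightarrow> finite S)"
    using x y by (meson finite_Un finite_subset)
qed

lift_definition uminus_grassmann :: "'a grassmann \<Rightarrow> 'a grassmann" is "\<lambda>x S. - x S"
  by simp

definition minus_grassmann :: "'a grassmann \<Rightarrow> 'a grassmann \<Rightarrow> 'a grassmann"
  where "minus_grassmann x y = x + - y"

text \<open>Bilinear extension of \<open>e\<^sub>S e\<^sub>T = \<plusminus> e\<^bsub>S \<union> T\<^esub>\<close> for disjoint \<open>S\<close> and \<open>T\<close>, and \<open>e\<^sub>S e\<^sub>T = 0\<close> otherwise.\<close>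

lift_definition times_grassmann :: "'a grassmann \<Rightarrow> 'a grassmann \<Rightarrow> 'a grassmann"
  is "\<lambda>x y U. \<Sum>S\<in>Pow U. shuffle_sign S (U - S) * x S * y (U - S)"
proof -
  fix x y :: "nat set \<Rightarrow> 'a"
  assume x: "finite {S. x S \<noteq> 0} \<and> (\<forall>S. x S \<noteq> 0 \<longrightarrow> finite S)"
    and y: "finite {S. y S \<noteq> 0} \<and> (\<forall>S. y S \<noteq> 0 \<longrightarrow> finite S)"
  let ?z = "\<lambda>U. \<Sum>S\<in>Pow U. shuffle_sign S (U - S) * x S * y (U - S)"
  have U: "U \<in> (\<lambda>(S, T). S \<union> T) ` ({S. x S \<noteq> 0} \<times> {S. y S \<noteq> 0})" if U: "?z U \<noteq> 0" for U
  proof -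
    obtain S where S: "S \<in> Pow U" "shuffle_sign S (U - S) * x S * y (U - S) \<noteq> 0"
      using U by (meson sum.not_neutral_contains_not_neutral)
    then have "x S \<noteq> 0" "y (U - S) \<noteq> 0" "S \<union> (U - S) = U"
      by auto
    then show ?thesis
      by (force simp: image_iff)
  qed
  have "finite {U. ?z U \<noteq> 0}"
    by (rule finite_subset[of _ "(\<lambda>(S, T). S \<union> T) ` ({S. x S \<noteq> 0} \<times> {S. y S \<noteq> 0})"])
      (use x y U in auto)
  moreover have "finite U" if "?z U \<noteq> 0" for U
    using U[OF that] x y by auto
  ultimately show "finite {U. ?z U \<noteq> 0} \<and> (\<forall>U. ?z U \<noteq> 0 \<longrightarrow> finite U)"
    by blast
qed

instance
proof
  fix x y z :: "'a grassmann"
  show "x + y + z = x + (y + z)" "x + y = y + x" "0 + x = x" "- x + x = 0"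
    by (transfer; simp add: fun_eq_iff add.assoc add.commute)+
  show "x - y = x + - y"
    by (rule minus_grassmann_def)
  show "(0::'a grassmann) \<noteq> 1"
    by transfer (auto simp: fun_eq_iff)
  show "(x + y) * z = x * z + y * z" "x * (y + z) = x * y + x * z"
    by (transfer; simp add: fun_eq_iff algebra_simps sum.distrib)+
  show "1 * x = x"
  proof (transfer, rule ext)
    fix x :: "nat set \<Rightarrow> 'a" and U
    assume x: "finite {S. x S \<noteq> 0} \<and> (\<forall>S. x S \<noteq> 0 \<longrightarrow> finite S)"
    show "(\<Sum>S\<in>Pow U. shuffle_sign S (U - S) * (if S = {} then 1 else 0) * x (U - S)) = x U"
    proof (cases "finite U")
      case True
      have "(\<Sum>S\<in>Pow U. shuffle_sign S (U - S) * (if S = {} then 1 else 0) * x (U - S)) =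
          (\<Sum>S\<in>{{}}. x (U - S))"
        by (rule sum.mono_neutral_cong_right) (use True in auto)
      then show ?thesis by simp
    qed (use x in auto)
  qed
  show "x * 1 = x"
  proof (transfer, rule ext)
    fix x :: "nat set \<Rightarrow> 'a" and U
    assume x: "finite {S. x S \<noteq> 0} \<and> (\<forall>S. x S \<noteq> 0 \<longrightarrow> finite S)"
    show "(\<Sum>S\<in>Pow U. shuffle_sign S (U - S) * x S * (if U - S = {} then 1 else 0)) = x U"
    proof (cases "finite U")
      case True
      have "(\<Sum>S\<in>Pow U. shuffle_sign S (U - S) * x S * (if U - S = {} then 1 else 0)) =
          (\<Sum>S\<in>{U}. x S)"
        by (rule sum.mono_neutral_cong_right) (use True in auto)
      then show ?thesis by simp
    qed (use x in auto)
  qed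
  show "x * y * z = x * (y * z)"
  proof (transfer, rule ext)
    fix x y z :: "nat set \<Rightarrow> 'a" and U
    let ?s = "shuffle_sign :: nat set \<Rightarrow> nat set \<Rightarrow> 'a"
    show "(\<Sum>S\<in>Pow U. ?s S (U - S) * (\<Sum>T\<in>Pow S. ?s T (S - T) * x T * y (S - T)) * z (U - S)) =
      (\<Sum>T\<in>Pow U. ?s T (U - T) * x T * (\<Sum>R\<in>Pow (U - T). ?s R (U - T - R) * y R * z (U - T - R)))"
      (is "?l = ?r")
    proof (cases "finite U")
      case U: True
      have fin: "finite S" if "S \<subseteq> U" for S
        using U that finite_subset by blast
      have "?l = (\<Sum>(S, T)\<in>Sigma (Pow U) Pow.
          ?s S (U - S) * ?s T (S - T) * x T * y (S - T) * z (U - S))"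
        by (subst sum.Sigma[symmetric])
          (use U fin in \<open>auto simp: sum_distrib_left sum_distrib_right mult_ac\<close>)
      also have "\<dots> = (\<Sum>(T, R)\<in>Sigma (Pow U) (\<lambda>T. Pow (U - T)).
          ?s T (U - T) * ?s R (U - T - R) * x T * y R * z (U - T - R))"
      proof (rule sum.reindex_bij_witness[of _ "\<lambda>(T, R). (T \<union> R, T)" "\<lambda>(S, T). (T, S - T)"],
          goal_cases)
        case (5 a)
        obtain S T where a: "a = (S, T)" "S \<subseteq> U" "T \<subseteq> S"
          using 5 by auto
        have UT: "S - T \<union> (U - S) = U - T" "(S - T) \<inter> (U - S) = {}" "finite (U - S)" "finite (S - T)"
          using a fin by auto
        have "?s T (U - T) = ?s T (S - T) * ?s T (U - S)"
          using shuffle_sign_Un_right[of T "S - T" "U - S", where 'a = 'a] a fin[of T]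
          by (simp add: UT)
        moreover have "?s S (U - S) = ?s T (U - S) * ?s (S - T) (U - S)"
          using shuffle_sign_Un_left[of T "S - T" "U - S", where 'a = 'a] a fin[of T] UT
          by (simp add: Un_absorb1)
        moreover have "U - T - (S - T) = U - S"
          using a by auto
        ultimately show ?case
          using a by (simp add: mult_ac)
      qed auto
      also have "\<dots> = ?r"
        by (subst sum.Sigma[symmetric])
          (use U fin in \<open>auto simp: sum_distrib_left sum_distrib_right mult_ac\<close>)
      finally show ?thesis .
    qed auto
  qed
qed

end

lift_definition grassmann_scale :: "'a::field \<Rightarrow> 'a grassmann \<Rightarrow> 'a grassmann"
  is "\<lambda>c x S. c * x S"
  by (auto elim: rev_finite_subset)

interpretation grassmann: unital_algebra grassmann_scale
proof
  fix a b :: 'a and x y :: "'a grassmann"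
  show "grassmann_scale a (x + y) = grassmann_scale a x + grassmann_scale a y"
    "grassmann_scale (a + b) x = grassmann_scale a x + grassmann_scale b x"
    "grassmann_scale a (grassmann_scale b x) = grassmann_scale (a * b) x"
    "grassmann_scale 1 x = x"
    by (transfer; simp add: fun_eq_iff algebra_simps)+
  show "grassmann_scale a x * y = grassmann_scale a (x * y)"
    "x * grassmann_scale a y = grassmann_scale a (x * y)"
    by (transfer; simp add: fun_eq_iff sum_distrib_left mult_ac)+
qed

text \<open>The basis element with support \<open>S\<close>; its length is \<open>card S\<close>.  It is \<open>0\<close> if \<open>S\<close> is infinite.\<close>

lift_definition basis_elem :: "nat set \<Rightarrow> 'a::comm_ring_1 grassmann"
  is "\<lambda>S T. if finite S \<and> T = S then 1 else 0"
  by auto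

definition generator :: "nat \<Rightarrow> 'a::comm_ring_1 grassmann"
  where "generator i = basis_elem {i}"

lemma basis_elem_empty: "basis_elem {} = 1"
  by transfer auto

lemma basis_elem_mult:
  assumes "finite S" "finite T"
  shows "basis_elem S * basis_elem T =
    (if S \<inter> T = {} then grassmann_scale (shuffle_sign S T) (basis_elem (S \<union> T)) else 0)"
proof (rule iffD1[OF coord_inject], rule ext)
  fix U
  let ?s = "shuffle_sign :: nat set \<Rightarrow> nat set \<Rightarrow> 'a"
  let ?g = "\<lambda>A. ?s A (U - A) * (if finite S \<and> A = S then 1 else 0) *
    (if finite T \<and> U - A = T then 1 else 0)"
  have "coord (basis_elem S * basis_elem T) U = (\<Sum>A\<in>Pow U. ?g A)"
    by transfer simp
  also have "\<dots> = (if S \<inter> T = {} \<and> U = S \<union> T then ?s S T else 0)"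
  proof (cases "S \<inter> T = {} \<and> U = S \<union> T")
    case True
    then have "U - S = T"
      by auto
    moreover have "(\<Sum>A\<in>Pow U. ?g A) = (\<Sum>A\<in>{S}. ?g A)"
      by (rule sum.mono_neutral_right) (use True assms in auto)
    ultimately show ?thesis
      using True assms by simp
  next
    case False
    then have "(\<Sum>A\<in>Pow U. ?g A) = 0"
      by (intro sum.neutral) auto
    then show ?thesis
      unfolding if_not_P[OF False] .
  qed
  also have "\<dots> = coord (if S \<inter> T = {} then grassmann_scale (?s S T) (basis_elem (S \<union> T)) else 0) U"
    using assms by (cases "S \<inter> T = {}"; simp; transfer; simp)
  finally show "coord (basis_elem S * basis_elem T) U = \<dots>" .
qed

lemma shuffle_sign_less: "\<forall>i\<in>S. \<forall>j\<in>T. i < j \<Longrightarrow> shuffle_sign S T = 1"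
proof -
  assume "\<forall>i\<in>S. \<forall>j\<in>T. i < j"
  then have "{(i, j). i \<in> S \<and> j \<in> T \<and> j < i} = {}"
    by force
  then show ?thesis
    unfolding shuffle_sign_def by (simp only: card.empty power_0)
qed

lemma generator_anticommute_less:
  assumes "i < j"
  shows "generator j * generator i = - (generator i * generator j :: 'a::field grassmann)"
proof -
  have "{(i', j'). i' \<in> {j} \<and> j' \<in> {i} \<and> j' < i'} = {(j, i)}"
    using assms by auto
  then have "shuffle_sign {j} {i} = (- 1 :: 'a)"
    by (simp add: shuffle_sign_def)
  then show ?thesis
    using assms
    by (simp add: generator_def basis_elem_mult shuffle_sign_less insert_commute
        grassmann.scale_minus_left)
qed

lemma generator_anticommute:
  "generator i * generator j = - (generator j * generator i :: 'a::field grassmann)"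
proof (cases i j rule: linorder_cases)
  case equal
  then show ?thesis
    by (simp add: generator_def basis_elem_mult)
qed (simp_all add: generator_anticommute_less)

lemma basis_elem_conv_prod_list:
  "finite S \<Longrightarrow> (basis_elem S :: 'a::field grassmann) = prod_list (map generator (sorted_list_of_set S))"
proof (induction S rule: finite_linorder_min_induct)
  case (insert i S)
  have "Min (insert i S) = i"
    using insert by (intro Min_eqI) auto
  moreover have "insert i S - {i} = S"
    using insert by auto
  ultimately have "sorted_list_of_set (insert i S) = i # sorted_list_of_set S"
    using insert sorted_list_of_set_nonempty[of "insert i S"] by simp
  moreover have "generator i * basis_elem S = (basis_elem (insert i S) :: 'a grassmann)"
    using insert.hyps by (auto simp: generator_def basis_elem_mult shuffle_sign_less)
  ultimately show ?case
    using insert.IH by simp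
qed (simp add: basis_elem_empty)


section \<open>Central gradings\<close>

definition homogeneous_grading :: "(int \<Rightarrow> 'a::field grassmann set) \<Rightarrow> bool"
  where "homogeneous_grading A \<longleftrightarrow> grassmann.grading A \<and> (\<forall>i. \<exists>r. generator i \<in> A r)"

definition full_support :: "(int \<Rightarrow> 'a::field grassmann set) \<Rightarrow> bool"
  where "full_support A \<longleftrightarrow> (\<forall>r. A r \<noteq> {0})"

definition central_grading :: "(int \<Rightarrow> 'a::field grassmann set) \<Rightarrow> bool"
  where "central_grading A \<longleftrightarrow> homogeneous_grading A \<and> full_support A \<and>
    (\<forall>h. even h \<longrightarrow> (\<exists>W. infinite W \<and> pairwise disjnt W \<and>
      (\<forall>S\<in>W. finite S \<and> even (card S) \<and> basis_elem S \<in> A h)))"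

end

theory Submission
  imports Defs
begin

text \<open>
  Substituting for the variables of \<open>\<pi>(f)\<close> amounts to substituting for those of \<open>f\<close> elements that
  have the prescribed degree only modulo 2; so \<open>\<pi>(f)\<close> being an identity is a priori the
  stronger condition, and the point is to get it from \<open>f\<close> being an identity.

  The variables are relaxed one at a time.  As \<open>f\<close> is linear in the variable \<open>v\<close> of degree \<open>n\<close>, only
  values \<open>x \<in> A r\<close> with \<open>r \<equiv> n\<close> modulo 2 need to be considered.  The degree \<open>n - r\<close> is even, so
  centrality provides infinitely many basis elements \<open>b \<in> A (n - r)\<close> of even length with disjoint
  supports.  Such a \<open>b\<close> is central in the algebra, hence multiplying \<open>x\<close> by \<open>b\<close> multiplies the value
  \<open>y\<close> of \<open>f\<close> by \<open>b\<close>; and \<open>x b\<close> has degree \<open>n\<close>, so \<open>y b = 0\<close>.  The support of \<open>b\<close> can be chosen away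
  from the finitely many generators that occur in \<open>y\<close>, and then \<open>y b = 0\<close> forces \<open>y = 0\<close>.

  The facts that carry this are \<open>basis_elem_even_central\<close>, \<open>mult_basis_elem_eq_0\<close> and
  \<open>eval_eq_sum_at_variable\<close>; \<open>eval_zero_on_induced_component\<close> combines them.
\<close>

section \<open>Evaluation in an algebra\<close>

lemma (in unital_algebra) eval_cong:
  assumes "\<And>w v. w \<in> Poly_Mapping.keys f \<Longrightarrow> v \<in> set (letters w) \<Longrightarrow> \<phi> v = \<psi> v"
  shows "eval \<phi> f = eval \<psi> f"
  unfolding eval_def
  by (intro sum.cong refl arg_cong2[where f = scale] arg_cong[where f = prod_list] map_cong)
    (use assms in auto)

lemma (in unital_algebra) eval_free_scale: "eval \<phi> (free_scale c f) = c *s eval \<phi> f"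
  using eval_single[of \<phi> 0 c] by (simp add: free_scale_conv_mult eval_mult mult_scale_left)

lemma (in unital_algebra) eval_prod_list: "eval \<phi> (prod_list fs) = prod_list (map (eval \<phi>) fs)"
  by (induction fs) (simp_all add: eval_one eval_mult)

lemma (in unital_algebra) eval_reduction: "eval \<psi> (reduction \<sigma> f) = eval (\<psi> \<circ> \<sigma>) f"
  unfolding reduction_def free.eval_def eval_sum eval_free_scale eval_prod_list
  by (simp add: eval_def[of _ f] eval_var comp_def)

text \<open>Every word splits at its only occurrence of \<open>v\<close>, and the two sides do not depend on the value
  of \<open>v\<close>.  This form of linearity in \<open>v\<close> also shows that central factors of that value can be
  pulled out.\<close>

lemma (in unital_algebra) eval_eq_sum_at_variable:
  assumes "\<forall>w\<in>Poly_Mapping.keys f. distinct (letters w) \<and> v \<in> set (letters w)"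
  shows "\<exists>P Q. \<forall>x. eval (\<phi>(v := x)) f =
    (\<Sum>w\<in>Poly_Mapping.keys f. Poly_Mapping.lookup f w *s (P w * x * Q w))"
proof -
  have "\<exists>p q. \<forall>x. prod_list (map (\<phi>(v := x)) (letters w)) = p * x * q"
    if w_key: "w \<in> Poly_Mapping.keys f" for w
  proof -
    obtain us vs where w: "letters w = us @ v # vs"
      using assms w_key by (meson split_list)
    then have "v \<notin> set us" "v \<notin> set vs"
      using assms w_key by auto
    then have "map (\<phi>(v := x)) us = map \<phi> us" "map (\<phi>(v := x)) vs = map \<phi> vs" for x
      by auto
    then have "prod_list (map (\<phi>(v := x)) (letters w)) =
        prod_list (map \<phi> us) * x * prod_list (map \<phi> vs)" for x
      by (simp only: w map_append list.map prod_list.append prod_list.Cons fun_upd_same mult.assoc)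
    then show ?thesis
      by blast
  qed
  then obtain P Q where "\<And>w x. w \<in> Poly_Mapping.keys f \<Longrightarrow>
      prod_list (map (\<phi>(v := x)) (letters w)) = P w * x * Q w"
    by metis
  then have "\<forall>x. eval (\<phi>(v := x)) f =
      (\<Sum>w\<in>Poly_Mapping.keys f. Poly_Mapping.lookup f w *s (P w * x * Q w))"
    by (simp add: eval_def)
  then show ?thesis
    by blast
qed

lemma (in unital_algebra) subspace_eval_eq_0:
  assumes "\<forall>w\<in>Poly_Mapping.keys f. distinct (letters w) \<and> v \<in> set (letters w)"
  shows "subspace {x. eval (\<phi>(v := x)) f = 0}"
proof -
  obtain P Q where eq: "\<And>x. eval (\<phi>(v := x)) f =
      (\<Sum>w\<in>Poly_Mapping.keys f. Poly_Mapping.lookup f w *s (P w * x * Q w))"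
    using eval_eq_sum_at_variable[OF assms, of \<phi>] by blast
  have "eval (\<phi>(v := x + y)) f = eval (\<phi>(v := x)) f + eval (\<phi>(v := y)) f" for x y
    by (simp add: eq distrib_left distrib_right scale_right_distrib sum.distrib)
  moreover have "eval (\<phi>(v := c *s x)) f = c *s eval (\<phi>(v := x)) f" for c x
    by (simp add: eq mult_scale_left mult_scale_right scale_sum_right mult.commute)
  moreover have "eval (\<phi>(v := 0)) f = 0"
    by (simp add: eq)
  ultimately show ?thesis
    by (auto intro!: subspaceI)
qed

lemma (in unital_algebra) eval_mult_central:
  assumes "\<forall>w\<in>Poly_Mapping.keys f. distinct (letters w) \<and> v \<in> set (letters w)"
    and central: "\<And>z. z * b = b * z"
  shows "eval (\<phi>(v := x * b)) f = eval (\<phi>(v := x)) f * b"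
proof -
  obtain P Q where eq: "\<And>x. eval (\<phi>(v := x)) f =
      (\<Sum>w\<in>Poly_Mapping.keys f. Poly_Mapping.lookup f w *s (P w * x * Q w))"
    using eval_eq_sum_at_variable[OF assms(1), of \<phi>] by blast
  have "P w * (x * b) * Q w = P w * x * Q w * b" for w
    by (simp add: mult.assoc central[of "Q w"])
  then show ?thesis
    by (simp add: eq sum_distrib_right mult_scale_left)
qed


section \<open>Multiplication by basis elements of the Grassmann algebra\<close>

lemma coord_mult:
  "coord (x * y) U = (\<Sum>S\<in>Pow U. shuffle_sign S (U - S) * coord x S * coord y (U - S))"
  by (simp add: times_grassmann.rep_eq)

lemma coord_basis_elem: "coord (basis_elem S) T = (if finite S \<and> T = S then 1 else 0)"
  by (simp add: basis_elem.rep_eq)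

lemma finite_coord: "finite {S. coord x S \<noteq> 0}" "coord x S \<noteq> 0 \<Longrightarrow> finite S"
  using coord[of x] by auto

lemma coord_mult_basis_elem:
  assumes "finite U" "T \<subseteq> U"
  shows "coord (x * basis_elem T) U = shuffle_sign (U - T) T * coord x (U - T)"
proof -
  have "finite T"
    using assms finite_subset by blast
  have "coord (x * basis_elem T) U =
      (\<Sum>S\<in>{U - T}. shuffle_sign S (U - S) * coord x S * coord (basis_elem T) (U - S))"
    unfolding coord_mult
    by (rule sum.mono_neutral_right) (use assms in \<open>auto simp: coord_basis_elem\<close>)
  then show ?thesis
    using assms \<open>finite T\<close> by (simp add: coord_basis_elem double_diff)
qed

lemma coord_basis_elem_mult:
  assumes "finite U" "T \<subseteq> U"
  shows "coord (basis_elem T * x) U = shuffle_sign T (U - T) * coord x (U - T)"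
proof -
  have "finite T"
    using assms finite_subset by blast
  have "coord (basis_elem T * x) U =
      (\<Sum>S\<in>{T}. shuffle_sign S (U - S) * coord (basis_elem T) S * coord x (U - S))"
    unfolding coord_mult
    by (rule sum.mono_neutral_right) (use assms in \<open>auto simp: coord_basis_elem\<close>)
  then show ?thesis
    using assms \<open>finite T\<close> by (simp add: coord_basis_elem)
qed

text \<open>Each pair in \<open>S \<times> T\<close> is an inversion of exactly one of the two concatenations, so the two
  inversion numbers add up to \<open>card S * card T\<close>, which is even.\<close>

lemma shuffle_sign_commute_even:
  assumes "finite S" "finite T" "S \<inter> T = {}" "even (card T)"
  shows "shuffle_sign S T = (shuffle_sign T S :: 'a::ring_1)"
proof -
  define I where "I = {(i, j). i \<in> S \<and> j \<in> T \<and> j < i}"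
  define J where "J = {(i, j). i \<in> T \<and> j \<in> S \<and> j < i}"
  have "I \<union> prod.swap ` J = S \<times> T" "I \<inter> prod.swap ` J = {}"
    using assms(3) by (auto simp: I_def J_def image_iff Bex_def)
  moreover have "finite I" "finite J"
    unfolding I_def J_def by (rule finite_inversions; fact)+
  ultimately have "card I + card J = card S * card T"
    using card_Un_disjoint[of I "prod.swap ` J"]
    by (simp add: card_image card_cartesian_product)
  then have "even (card I) \<longleftrightarrow> even (card J)"
    using assms(4) by (metis even_add even_mult_iff)
  then show ?thesis
    by (simp add: shuffle_sign_def flip: I_def J_def) (simp add: uminus_power_if)
qed

lemma basis_elem_even_central:
  assumes "even (card T)"
  shows "x * basis_elem T = basis_elem T * (x :: 'a::comm_ring_1 grassmann)"
proof (rule iffD1[OF coord_inject], rule ext)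
  fix U
  show "coord (x * basis_elem T) U = coord (basis_elem T * x) U"
  proof (cases "finite U \<and> T \<subseteq> U")
    case True
    then have "shuffle_sign (U - T) T = (shuffle_sign T (U - T) :: 'a)"
      using assms finite_subset by (intro shuffle_sign_commute_even) auto
    with True show ?thesis
      by (simp add: coord_mult_basis_elem coord_basis_elem_mult)
  next
    case False
    have "S \<noteq> T \<or> coord x (U - S) = 0" "U - S \<noteq> T \<or> coord x S = 0"
      if "S \<subseteq> U" "finite T" for S
      using False that finite_coord(2)[of x "U - S"] finite_coord(2)[of x S] finite_Diff2[of S U]
      by fastforce+
    then have "coord (x * basis_elem T) U = 0" "coord (basis_elem T * x) U = 0"
      by (auto simp: coord_mult coord_basis_elem intro!: sum.neutral)
    then show ?thesis
      by simp
  qed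
qed

text \<open>For supports \<open>S\<close> disjoint from \<open>T\<close>, the map \<open>S \<mapsto> S \<union> T\<close> is injective, so no coordinate of \<open>x\<close>
  can cancel in the product.\<close>

lemma mult_basis_elem_eq_0:
  assumes "x * basis_elem T = 0" "finite T" "\<And>S. coord x S \<noteq> 0 \<Longrightarrow> S \<inter> T = {}"
  shows "x = 0"
proof (rule iffD1[OF coord_inject], rule ext, rule ccontr)
  fix S
  assume "coord x S \<noteq> coord 0 S"
  then have S: "coord x S \<noteq> 0"
    by (simp add: zero_grassmann.rep_eq)
  then have "S \<union> T - T = S" "finite (S \<union> T)"
    using assms(2,3) finite_coord(2) by auto
  then have "shuffle_sign S T * coord x S = 0"
    using coord_mult_basis_elem[of "S \<union> T" T x] assms(1) by (simp add: zero_grassmann.rep_eq)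
  moreover have "shuffle_sign S T * (shuffle_sign S T * coord x S) = coord x S"
    by (simp add: shuffle_sign_def mult.assoc[symmetric] flip: power_mult_distrib)
  ultimately show False
    using S by simp
qed

lemma pairwise_disjnt_avoids_finite:
  assumes "infinite W" "pairwise disjnt W" "finite K"
  obtains T where "T \<in> W" "T \<inter> K = {}"
proof (rule ccontr)
  assume "\<not> thesis"
  then have "\<forall>T\<in>W. \<exists>k. k \<in> T \<inter> K"
    using that by blast
  then obtain k where k: "\<And>T. T \<in> W \<Longrightarrow> k T \<in> T \<inter> K"
    by metis
  then have "inj_on k W"
    using assms(2) unfolding inj_on_def pairwise_def disjnt_def by (metis IntD1 disjoint_iff)
  moreover have "k ` W \<subseteq> K"
    using k by auto
  ultimately show False
    using assms(1,3) by (meson finite_imageD finite_subset)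
qed


section \<open>From degrees to degrees modulo 2\<close>

lemma even_iff_of_int_bit: "of_int r = (of_int n :: bit) \<longleftrightarrow> even (n - r)"
proof -
  have "of_int m = (of_bool (odd m) :: bit)" for m :: int
    by (cases m rule: parity_cases; elim evenE oddE; simp)
  then show ?thesis
    by auto
qed

lemma eval_zero_on_induced_component:
  assumes "central_grading A"
    and multi: "\<forall>w\<in>Poly_Mapping.keys f. distinct (letters w) \<and> v \<in> set (letters w)"
    and zero: "\<And>x. x \<in> A n \<Longrightarrow> grassmann.eval (\<phi>(v := x)) f = 0"
    and "y \<in> grassmann.induced_grading A (of_int n)"
  shows "grassmann.eval (\<phi>(v := y)) f = 0"
proof -
  have "grassmann.eval (\<phi>(v := x)) f = 0" if "of_int r = (of_int n :: bit)" "x \<in> A r" for r x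
  proof -
    let ?y = "grassmann.eval (\<phi>(v := x)) f"
    have "even (n - r)"
      using that(1) by (simp add: even_iff_of_int_bit)
    then obtain W where W: "infinite W" "pairwise disjnt W"
        "\<forall>S\<in>W. finite S \<and> even (card S) \<and> basis_elem S \<in> A (n - r)"
      using assms(1) unfolding central_grading_def by blast
    have "finite (\<Union>{S. coord ?y S \<noteq> 0})"
      using finite_coord[of ?y] by blast
    then obtain T where T: "T \<in> W" "T \<inter> \<Union>{S. coord ?y S \<noteq> 0} = {}"
      using W(1,2) pairwise_disjnt_avoids_finite by metis
    have "\<forall>g h. \<forall>x\<in>A g. \<forall>y\<in>A h. x * y \<in> A (g + h)"
      using assms(1)
      unfolding central_grading_def homogeneous_grading_def grassmann.grading_def by simp
    then have "x * basis_elem T \<in> A (r + (n - r))"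
      using W(3) T(1) that(2) by blast
    then have "grassmann.eval (\<phi>(v := x * basis_elem T)) f = 0"
      using zero by simp
    moreover have "z * basis_elem T = basis_elem T * z" for z :: "'a grassmann"
      using W(3) T(1) by (intro basis_elem_even_central) blast
    ultimately have "?y * basis_elem T = 0"
      using grassmann.eval_mult_central[OF multi] by metis
    then show "?y = 0"
      by (rule mult_basis_elem_eq_0) (use W(3) T in auto)
  qed
  then have "(\<Union>r\<in>{r. of_int r = (of_int n :: bit)}. A r) \<subseteq> {x. grassmann.eval (\<phi>(v := x)) f = 0}"
    by auto
  then have "grassmann.induced_grading A (of_int n) \<subseteq> {x. grassmann.eval (\<phi>(v := x)) f = 0}"
    unfolding grassmann.induced_grading_def
    using grassmann.subspace_eval_eq_0[OF multi] by (rule grassmann.span_minimal)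
  with assms(4) show ?thesis
    by auto
qed

text \<open>\<open>U\<close> is the set of variables whose degree is already prescribed only modulo 2.  The
  induction runs over all substitutions at once: when \<open>v\<close> joins \<open>U\<close>, the hypothesis is needed for every
  value of \<open>v\<close> in its component, with the other values kept.\<close>

lemma eval_zero_on_induced_components:
  assumes "central_grading A" "f \<in> grassmann.graded_identities A"
    and multi: "\<forall>w\<in>Poly_Mapping.keys f. distinct (letters w) \<and> set (letters w) = V"
    and "finite U" "U \<subseteq> V"
    and "\<And>v. v \<in> U \<Longrightarrow> \<phi> v \<in> grassmann.induced_grading A (of_int (fst v))"
    and "\<And>v. v \<notin> U \<Longrightarrow> \<phi> v \<in> A (fst v)"
  shows "grassmann.eval \<phi> f = 0"
  using assms(4-)
proof (induction U arbitrary: \<phi>)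
  case empty
  then show ?case
    using assms(2) by (auto simp: grassmann.graded_identities_def)
next
  case (insert v U)
  have zero: "grassmann.eval (\<phi>(v := x)) f = 0" if "x \<in> A (fst v)" for x
  proof (rule insert.IH)
    show "U \<subseteq> V"
      using insert.prems by simp
    show "(\<phi>(v := x)) u \<in> grassmann.induced_grading A (of_int (fst u))" if "u \<in> U" for u
      using insert.prems(2)[of u] insert.hyps that by auto
    show "(\<phi>(v := x)) u \<in> A (fst u)" if "u \<notin> U" for u
      using insert.prems(3)[of u] that \<open>x \<in> A (fst v)\<close> by auto
  qed
  have "\<forall>w\<in>Poly_Mapping.keys f. distinct (letters w) \<and> v \<in> set (letters w)"
    using insert.prems(1) multi by blast
  then have "grassmann.eval (\<phi>(v := \<phi> v)) f = 0"
    by (rule eval_zero_on_induced_component[OF assms(1) _ zero]) (use insert.prems(2)[of v] in auto)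
  then show ?case
    by simp
qed

theorem theorem5p6:
  fixes A :: "int \<Rightarrow> 'a::field_char_0 grassmann set"
    and f :: "(int, 'a) free_algebra"
    and \<sigma> :: "int \<times> nat \<Rightarrow> bit \<times> nat"
  assumes "multilinear f"
    and "central_grading A"
    and "reduces_mod_2 \<sigma>"
  shows "f \<in> grassmann.graded_identities A \<longleftrightarrow>
    reduction \<sigma> f \<in> grassmann.graded_identities (grassmann.induced_grading A)"
proof
  have \<sigma>: "inj \<sigma>" "\<And>v. fst (\<sigma> v) = of_int (fst v)"
    using assms(3) by (auto simp: reduces_mod_2_def)
  have zero: "0 \<in> A r" for r
    using assms(2) unfolding central_grading_def homogeneous_grading_def grassmann.grading_def
    by (meson grassmann.subspace_0)
  {
    assume f: "f \<in> grassmann.graded_identities A"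
    obtain V where V: "finite V"
        "\<forall>w\<in>Poly_Mapping.keys f. distinct (letters w) \<and> set (letters w) = V"
      using assms(1) unfolding multilinear_def by blast
    have "grassmann.eval \<psi> (reduction \<sigma> f) = 0"
      if \<psi>: "\<forall>d i. \<psi> (d, i) \<in> grassmann.induced_grading A d" for \<psi>
    proof -
      (* Outside V the values are immaterial; 0 is homogeneous of every degree. *)
      let ?\<phi> = "\<lambda>v. if v \<in> V then \<psi> (\<sigma> v) else 0"
      have "grassmann.eval \<psi> (reduction \<sigma> f) = grassmann.eval ?\<phi> f"
        unfolding grassmann.eval_reduction using V(2) by (intro grassmann.eval_cong) auto
      also have "\<dots> = 0"
      proof (rule eval_zero_on_induced_components[OF assms(2) f V(2) V(1) subset_refl])
        show "?\<phi> v \<in> grassmann.induced_grading A (of_int (fst v))" if "v \<in> V" for v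
          using \<psi> that by (metis \<sigma>(2) prod.collapse)
      qed (simp add: zero)
      finally show ?thesis .
    qed
    then show "reduction \<sigma> f \<in> grassmann.graded_identities (grassmann.induced_grading A)"
      by (simp add: grassmann.graded_identities_def)
  next
    assume \<pi>f: "reduction \<sigma> f \<in> grassmann.graded_identities (grassmann.induced_grading A)"
    have "grassmann.eval \<phi> f = 0" if \<phi>: "\<forall>n i. \<phi> (n, i) \<in> A n" for \<phi>
    proof -
      (* Distinct variables have distinct images, so \<phi> factors through \<sigma>. *)
      define \<psi> where "\<psi> = (\<lambda>u. if u \<in> range \<sigma> then \<phi> (inv \<sigma> u) else 0)"
      have "\<psi> u \<in> grassmann.induced_grading A (fst u)" for u
      proof (cases "u \<in> range \<sigma>")
        case True
        then obtain v where v: "u = \<sigma> v"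
          by auto
        then have "\<psi> u = \<phi> v"
          using \<sigma>(1) by (simp add: \<psi>_def)
        moreover have "\<phi> v \<in> A (fst v)"
          using \<phi>[rule_format, of "fst v" "snd v"] by simp
        ultimately show ?thesis
          unfolding grassmann.induced_grading_def
          by (intro grassmann.span_base) (auto simp: v \<sigma>(2))
      qed (simp add: \<psi>_def grassmann.induced_grading_def grassmann.span_zero)
      then have "\<forall>d i. \<psi> (d, i) \<in> grassmann.induced_grading A d"
        by (metis fst_conv)
      then have "grassmann.eval \<psi> (reduction \<sigma> f) = 0"
        using \<pi>f by (simp add: grassmann.graded_identities_def)
      moreover have "\<psi> \<circ> \<sigma> = \<phi>"
        using \<sigma>(1) by (auto simp: \<psi>_def)
      ultimately show ?thesis
        by (simp add: grassmann.eval_reduction)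
    qed
    then show "f \<in> grassmann.graded_identities A"
      by (simp add: grassmann.graded_identities_def)
  }
qed

end
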